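(* Let $\mathfrak{Z}$ be an $\mathbb{F}$-Fréchet space which is an algebra for a product $\cdot$ that is associative and continuous on $\mathfrak{Z}$, and let $(M,\mathcal{M})$ be a measurable space. Let $\theta\in\mathfrak{Z}$. Suppose that $\xi:\mathcal{M}\to\mathfrak{Z}'$ is an integrator with measure $\mu$ and map $\Xi$ such that there exists for every $x\in M$ a $\Xi_x\in L(\mathfrak{Z}',\sigma)$ such that for any $\gamma\in\mathcal{I}(\xi)$, $\Xi(\gamma)(x)=\Xi_x(\gamma(x))$. If the dual $\Xi_x^*$ restricted to $\mathfrak{Z}$ is a derivative operator (for every $x\in M$), then for every $\gamma\in\mathcal{I}(\xi)$ and every $E\in\mathcal{M}$, $$\int_E\theta\cdot\gamma(x)\,d\xi(x)=\theta\cdot\int_E\gamma(x)\,d\xi(x)-\int_E\Xi_x^*(\theta)\cdot\gamma(x)\,\mu(dx).$$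
   Context: $\mathbb{F}\in\{\mathbb{R},\mathbb{C}\}$. A Fréchet space is a metrizable, complete, locally convex topological vector space over $\mathbb{F}$; $\mathfrak{Z}'$ is its topological dual and $\langle z',z\rangle$ the dual pairing. $\mathfrak{Z}$ is viewed as a subspace of the algebraic dual $(\mathfrak{Z}')^*$ via evaluation. $\sigma(\mathfrak{Z}',\mathfrak{Z})$ is the weak star topology on $\mathfrak{Z}'$, i.e. the coarsest topology making all maps $z'\mapsto\langle z',z\rangle$, $z\in\mathfrak{Z}$, continuous. $L(\mathfrak{Z}',\sigma)$ is the space of linear, $\sigma(\mathfrak{Z}',\mathfrak{Z})$-$\sigma(\mathfrak{Z}',\mathfrak{Z})$ continuous operators on $\mathfrak{Z}'$. For $S\in L(\mathfrak{Z}',\sigma)$, the dual $S^*:(\mathfrak{Z}')^*\to(\mathfrak{Z}')^*$ is the algebraic adjoint; it satisfies $S^*(\mathfrak{Z})\subset\mathfrak{Z}$ and $\langle Sz',z\rangle=\langle z',S^*z\rangle$ for $z'\in\mathfrak{Z}'$, $z\in\mathfrak{Z}$. An algebra is an $\mathbb{F}$-vector space with a bilinear multiplication. For $\theta\in\mathfrak{Z}$ and $\eta\in\mathfrak{Z}'$, the element $\theta\cdot\eta\in\mathfrak{Z}'$ is defined by $\langle\theta\cdot\eta,z\rangle:=\langle\eta,\theta\cdot z\rangle$ for all $z\in\mathfrak{Z}$. A map $\Gamma:\mathfrak{Z}\to\mathfrak{Z}$ is a derivative operator if $\Gamma(y\cdot z)=y\cdot\Gamma(z)+\Gamma(y)\cdot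 z$ for all $y,z\in\mathfrak{Z}$. For $\gamma:M\to\mathfrak{Z}'$, $\theta\cdot\gamma$ denotes the map $x\mapsto\theta\cdot\gamma(x)$. For a $\sigma$-finite measure space $(M,\mathcal{M},\mu)$, a map $\psi:M\to\mathfrak{Z}'$ is $\mathfrak{Z}'$-Gelfand $\mu$-integrable if $x\mapsto\langle\psi(x),z\rangle\in L^1(\mu)$ for every $z\in\mathfrak{Z}$. For such $\psi$ and $E\in\mathcal{M}$, the Gelfand integral $\int_E\psi(x)\,\mu(dx)$ is the element of $\mathfrak{Z}'$ given by $z\mapsto\int_E\langle\psi(x),z\rangle\,\mu(dx)$ (this functional is continuous). Let $\mathcal{F}(M,\mathfrak{Z}')$ be the set of maps from $M$ to $\mathfrak{Z}'$. A map $\xi:\mathcal{M}\to\mathfrak{Z}'$ is an integrator (with measure $\mu$ and map $\Xi$) if there exist a $\sigma$-finite measure $\mu$ on $(M,\mathcal{M})$, a map $\Xi:\mathcal{F}(M,\mathfrak{Z}')\to\mathcal{F}(M,\mathfrak{Z}')$, and an element $u\in\mathfrak{Z}'$ (the unit element, regarded as the constant map $x\mapsto u$) such that $\Xi(u)$ is $\mathfrak{Z}'$-Gelfand $\mu$-integrable and $\xi(E)=\int_E\Xi(u)(x)\,\mu(dx)$ for all $E\in\mathcal{M}$. A map $\gamma:M\to\mathfrak{Z}'$ is integrable with respect to $\xi$, written $\gamma\in\mathcal{I}(\xi)$, if $\Xi(\gamma)$ is $\mathfrak{Z}'$-Gelfand $\mu$-integrable; then for $E\in\mathcal{M}$, 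$\int_E\gamma(x)\,d\xi(x):=\int_E\Xi(\gamma)(x)\,\mu(dx)\in\mathfrak{Z}'$.
   Formalization: The identity is proved for those γ in I(ξ) for which θ·γ is also in I(ξ); this does not follow from the stated hypotheses and is needed for the left-hand integral to be defined. *)

theory Defs
  imports "HOL-Analysis.Analysis"
begin

text \<open>
  The scalar field is a type of the classes \<open>real_normed_field\<close> and \<open>euclidean_space\<close>. Both
  \<open>real\<close> and \<open>complex\<close> are instances, and by the Gelfand-Mazur theorem every type of these
  classes is isomorphic, as a normed field, to one of these two.
\<close>

definition smul_convex :: "('k::real_normed_field \<Rightarrow> 'z::ab_group_add \<Rightarrow> 'z) \<Rightarrow> 'z set \<Rightarrow> bool"
  where "smul_convex smul C \<longleftrightarrow>
    (\<forall>x\<in>C. \<forall>y\<in>C. \<forall>t::real. 0 \<le> t \<and> t \<le> 1 \<longrightarrow>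
      smul (of_real (1 - t)) x + smul (of_real t) y \<in> C)"

text \<open>Completeness is that of the uniform structure of the topological vector space:
  every Cauchy filter converges.\<close>

locale frechet_space = vector_space smul
  for smul :: "'k::{real_normed_field,euclidean_space} \<Rightarrow> 'z::{ab_group_add,topological_space} \<Rightarrow> 'z" +
  assumes continuous_add: "continuous_on UNIV (\<lambda>(x::'z, y). x + y)"
    and continuous_scale: "continuous_on UNIV (\<lambda>(c, x). smul c x)"
    and metrizable: "metrizable_space (euclidean :: 'z topology)"
    and locally_convex: "\<And>U. open U \<Longrightarrow> 0 \<in> U \<Longrightarrow> \<exists>C. smul_convex smul C \<and> 0 \<in> interior C \<and> C \<subseteq> U"
    and complete: "\<And>F :: 'z filter. F \<noteq> bot \<Longrightarrow>
      (\<And>U. open U \<Longrightarrow> 0 \<in> U \<Longrightarrow> \<forall>\<^sub>F (x, y) in F \<times>\<^sub>F F. x - y \<in> U) \<Longrightarrow> \<exists>a. F \<le> nhds a"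

locale frechet_algebra = frechet_space smul
  for smul :: "'k::{real_normed_field,euclidean_space} \<Rightarrow> 'z::{ab_group_add,topological_space} \<Rightarrow> 'z" +
  fixes pmul :: "'z \<Rightarrow> 'z \<Rightarrow> 'z"
  assumes linear_mult_right: "\<And>y. Vector_Spaces.linear smul smul (\<lambda>z. pmul y z)"
    and linear_mult_left: "\<And>z. Vector_Spaces.linear smul smul (\<lambda>y. pmul y z)"
    and mult_assoc: "\<And>x y z. pmul (pmul x y) z = pmul x (pmul y z)"
    and continuous_mult: "continuous_on UNIV (\<lambda>(y, z). pmul y z)"

text \<open>The topological dual is a set of functions, so the pairing of \<open>f\<close> and \<open>z\<close> is \<open>f z\<close>.\<close>

definition dual :: "('k::real_normed_field \<Rightarrow> 'z::{ab_group_add,topological_space} \<Rightarrow> 'z) \<Rightarrow> ('z \<Rightarrow> 'k) set"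
  where "dual smul = {f. Vector_Spaces.linear smul (*) f \<and> continuous_on UNIV f}"

definition weak_star :: "('k::real_normed_field \<Rightarrow> 'z::{ab_group_add,topological_space} \<Rightarrow> 'z) \<Rightarrow> ('z \<Rightarrow> 'k) topology"
  where "weak_star smul =
    topology_generated_by {{f \<in> dual smul. f z \<in> U} | z U. open U}"

definition weak_star_operators ::
    "('k::real_normed_field \<Rightarrow> 'z::{ab_group_add,topological_space} \<Rightarrow> 'z) \<Rightarrow> (('z \<Rightarrow> 'k) \<Rightarrow> ('z \<Rightarrow> 'k)) set"
  where "weak_star_operators smul = {S.
     S \<in> dual smul \<rightarrow> dual smul \<and>
     (\<forall>f\<in>dual smul. \<forall>g\<in>dual smul. S (\<lambda>z. f z + g z) = (\<lambda>z. S f z + S g z)) \<and>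
     (\<forall>c. \<forall>f\<in>dual smul. S (\<lambda>z. c * f z) = (\<lambda>z. c * S f z)) \<and>
     continuous_map (weak_star smul) (weak_star smul) S}"

text \<open>\<open>evaluation\<close> embeds the space into the algebraic dual of its topological dual, and
  \<open>algebraic_adjoint S\<close> acts on that algebraic dual. For \<open>S\<close> in \<open>weak_star_operators\<close> it maps
  the range of the embedding (injective, by Hahn-Banach) into itself; \<open>dual_operator S\<close> is
  the resulting map on the space.\<close>

definition evaluation ::
    "('k::real_normed_field \<Rightarrow> 'z::{ab_group_add,topological_space} \<Rightarrow> 'z) \<Rightarrow> 'z \<Rightarrow> ('z \<Rightarrow> 'k) \<Rightarrow> 'k"
  where "evaluation smul z = (\<lambda>f\<in>dual smul. f z)"

definition algebraic_adjoint ::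
    "('k::real_normed_field \<Rightarrow> 'z::{ab_group_add,topological_space} \<Rightarrow> 'z) \<Rightarrow>
     (('z \<Rightarrow> 'k) \<Rightarrow> ('z \<Rightarrow> 'k)) \<Rightarrow> (('z \<Rightarrow> 'k) \<Rightarrow> 'k) \<Rightarrow> (('z \<Rightarrow> 'k) \<Rightarrow> 'k)"
  where "algebraic_adjoint smul S \<phi> = (\<lambda>f\<in>dual smul. \<phi> (S f))"

definition dual_operator ::
    "('k::real_normed_field \<Rightarrow> 'z::{ab_group_add,topological_space} \<Rightarrow> 'z) \<Rightarrow>
     (('z \<Rightarrow> 'k) \<Rightarrow> ('z \<Rightarrow> 'k)) \<Rightarrow> 'z \<Rightarrow> 'z"
  where "dual_operator smul S z =
    inv (evaluation smul) (algebraic_adjoint smul S (evaluation smul z))"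

definition derivative_operator :: "('z::plus \<Rightarrow> 'z \<Rightarrow> 'z) \<Rightarrow> ('z \<Rightarrow> 'z) \<Rightarrow> bool"
  where "derivative_operator pmul \<Gamma> \<longleftrightarrow>
    (\<forall>y z. \<Gamma> (pmul y z) = pmul y (\<Gamma> z) + pmul (\<Gamma> y) z)"

definition dual_mult :: "('z \<Rightarrow> 'z \<Rightarrow> 'z) \<Rightarrow> 'z \<Rightarrow> ('z \<Rightarrow> 'k) \<Rightarrow> ('z \<Rightarrow> 'k)"
  where "dual_mult pmul \<theta> \<eta> = (\<lambda>z. \<eta> (pmul \<theta> z))"

definition dual_maps ::
    "('k::real_normed_field \<Rightarrow> 'z::{ab_group_add,topological_space} \<Rightarrow> 'z) \<Rightarrow> 'm measure \<Rightarrow> ('m \<Rightarrow> 'z \<Rightarrow> 'k) set"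
  where "dual_maps smul M = (space M \<rightarrow>\<^sub>E dual smul)"

definition gelfand_integrable ::
    "('k::{real_normed_field,euclidean_space} \<Rightarrow> 'z::{ab_group_add,topological_space} \<Rightarrow> 'z) \<Rightarrow>
     'm measure \<Rightarrow> ('m \<Rightarrow> 'z \<Rightarrow> 'k) \<Rightarrow> bool"
  where "gelfand_integrable smul \<mu> \<psi> \<longleftrightarrow>
    \<psi> \<in> dual_maps smul \<mu> \<and> (\<forall>z. integrable \<mu> (\<lambda>x. \<psi> x z))"

definition gelfand_integral ::
    "'m measure \<Rightarrow> 'm set \<Rightarrow> ('m \<Rightarrow> 'z \<Rightarrow> 'k::{real_normed_field,euclidean_space}) \<Rightarrow> 'z \<Rightarrow> 'k"
  where "gelfand_integral \<mu> E \<psi> = (\<lambda>z. set_lebesgue_integral \<mu> E (\<lambda>x. \<psi> x z))"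

text \<open>Of \<open>M\<close> only the measurable space is used; its measure plays no role.\<close>

definition integrator ::
    "('k::{real_normed_field,euclidean_space} \<Rightarrow> 'z::{ab_group_add,topological_space} \<Rightarrow> 'z) \<Rightarrow>
     'm measure \<Rightarrow> 'm measure \<Rightarrow> (('m \<Rightarrow> 'z \<Rightarrow> 'k) \<Rightarrow> ('m \<Rightarrow> 'z \<Rightarrow> 'k)) \<Rightarrow> ('m set \<Rightarrow> 'z \<Rightarrow> 'k) \<Rightarrow> bool"
  where "integrator smul M \<mu> \<Xi> \<xi> \<longleftrightarrow>
    \<xi> \<in> sets M \<rightarrow> dual smul \<and>
    sigma_finite_measure \<mu> \<and> sets \<mu> = sets M \<and>
    \<Xi> \<in> dual_maps smul M \<rightarrow> dual_maps smul M \<and>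
    (\<exists>u\<in>dual smul.
      gelfand_integrable smul \<mu> (\<Xi> (\<lambda>x\<in>space M. u)) \<and>
      (\<forall>E\<in>sets M. \<xi> E = gelfand_integral \<mu> E (\<Xi> (\<lambda>x\<in>space M. u))))"

text \<open>Integrability and integrals with respect to an integrator depend on it only through
  its measure and its map.\<close>

definition integrable_maps ::
    "('k::{real_normed_field,euclidean_space} \<Rightarrow> 'z::{ab_group_add,topological_space} \<Rightarrow> 'z) \<Rightarrow>
     'm measure \<Rightarrow> (('m \<Rightarrow> 'z \<Rightarrow> 'k) \<Rightarrow> ('m \<Rightarrow> 'z \<Rightarrow> 'k)) \<Rightarrow> ('m \<Rightarrow> 'z \<Rightarrow> 'k) set"
  where "integrable_maps smul \<mu> \<Xi> =
    {\<gamma> \<in> dual_maps smul \<mu>. gelfand_integrable smul \<mu> (\<Xi> \<gamma>)}"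

definition integrator_integral ::
    "'m measure \<Rightarrow> (('m \<Rightarrow> 'z \<Rightarrow> 'k) \<Rightarrow> ('m \<Rightarrow> 'z \<Rightarrow> 'k)) \<Rightarrow> 'm set \<Rightarrow>
     ('m \<Rightarrow> 'z \<Rightarrow> 'k::{real_normed_field,euclidean_space}) \<Rightarrow> 'z \<Rightarrow> 'k"
  where "integrator_integral \<mu> \<Xi> E \<gamma> = gelfand_integral \<mu> E (\<Xi> \<gamma>)"

end

theory Submission
  imports Defs
begin

text \<open>
  Fix \<open>x\<close>, let \<open>D\<close> be the dual operator of \<open>\<Xi>\<^sub>p x\<close> and \<open>f = \<gamma> x\<close>. The duality
  \<open>\<Xi>\<^sub>p x f z = f (D z)\<close> turns the Leibniz rule for \<open>D\<close> into the pointwise identity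
  \<open>\<Xi>\<^sub>p x (\<theta> \<cdot> f) = \<theta> \<cdot> \<Xi>\<^sub>p x f - D \<theta> \<cdot> f\<close>; evaluating at \<open>z\<close> and integrating over \<open>E\<close>
  gives the claim. The Gelfand integrability of the last term comes from the same identity,
  because the other two terms are integrable.

  The duality rests on the fact that a weak-star continuous linear functional on the dual is the
  evaluation at some vector (lemma \<open>weak_star_functional_eq_evaluation\<close>). Such a functional is
  bounded on a weak-star neighbourhood of \<open>0\<close>, and this neighbourhood contains the subspace of
  functionals that vanish on some finite set \<open>F\<close>. A linear functional bounded on a subspace
  vanishes there, so it is a linear combination of the evaluations at the points of \<open>F\<close>, by
  \<open>functional_eq_combination_of_evaluations\<close>.
  Since \<open>dual_operator\<close> is defined by a choice of preimage under
  \<open>evaluation\<close>, the existence of a preimage is all that is needed; the injectivity of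
  \<open>evaluation\<close>, hence the Hahn-Banach theorem, does not enter.
\<close>

lemma dual_iff:
  "f \<in> dual smul \<longleftrightarrow> Vector_Spaces.linear smul (*) f \<and> continuous_on UNIV f"
  by (simp add: dual_def)

lemma dual_add_apply:
  assumes "f \<in> dual smul"
  shows "f (x + y) = f x + f y"
proof -
  interpret Vector_Spaces.linear smul "(*)" f using assms by (simp add: dual_iff)
  show ?thesis by (rule add)
qed

lemma dual_sum_scale_apply:
  assumes "f \<in> dual smul"
  shows "f (\<Sum>z\<in>F. smul (c z) z) = (\<Sum>z\<in>F. c z * f z)"
proof -
  interpret Vector_Spaces.linear smul "(*)" f using assms by (simp add: dual_iff)
  show ?thesis by (simp add: sum scale)
qed

context
  fixes smul :: "'k::real_normed_field \<Rightarrow> 'z::{ab_group_add,topological_space} \<Rightarrow> 'z"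
  assumes vs: "vector_space smul"
begin

lemma vector_space_pair_field: "vector_space_pair smul ((*) :: 'k \<Rightarrow> 'k \<Rightarrow> 'k)"
  unfolding vector_space_pair_def using vs by (simp add: vector_space_def algebra_simps)

lemma zero_in_dual: "(\<lambda>z. 0) \<in> dual smul"
proof -
  interpret vector_space_pair smul "(*) :: 'k \<Rightarrow> 'k \<Rightarrow> 'k" by (rule vector_space_pair_field)
  show ?thesis by (simp add: dual_iff linear_zero)
qed

lemma add_in_dual:
  assumes "f \<in> dual smul" "g \<in> dual smul"
  shows "(\<lambda>z. f z + g z) \<in> dual smul"
proof -
  interpret vector_space_pair smul "(*) :: 'k \<Rightarrow> 'k \<Rightarrow> 'k" by (rule vector_space_pair_field)
  show ?thesis
    using assms by (auto simp: dual_iff intro: linear_compose_add continuous_on_add)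
qed

lemma scale_in_dual:
  assumes "f \<in> dual smul"
  shows "(\<lambda>z. c * f z) \<in> dual smul"
proof -
  interpret vector_space_pair smul "(*) :: 'k \<Rightarrow> 'k \<Rightarrow> 'k" by (rule vector_space_pair_field)
  show ?thesis
    using assms by (auto simp: dual_iff intro: linear_compose_scale_right continuous_on_mult_left)
qed

end

text \<open>
  The standard fact that a linear functional is a combination of finitely many others as soon as
  it vanishes on their common kernel, for evaluations on a space \<open>V\<close> of functions.
\<close>

lemma functional_eq_combination_of_evaluations:
  fixes V :: "('z \<Rightarrow> 'k::field) set" and \<phi> :: "('z \<Rightarrow> 'k) \<Rightarrow> 'k"
  assumes "finite F"
    and V_add: "\<And>f g. f \<in> V \<Longrightarrow> g \<in> V \<Longrightarrow> (\<lambda>z. f z + g z) \<in> V"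
    and V_scale: "\<And>c f. f \<in> V \<Longrightarrow> (\<lambda>z. c * f z) \<in> V"
    and "\<And>f g. f \<in> V \<Longrightarrow> g \<in> V \<Longrightarrow> \<phi> (\<lambda>z. f z + g z) = \<phi> f + \<phi> g"
    and "\<And>c f. f \<in> V \<Longrightarrow> \<phi> (\<lambda>z. c * f z) = c * \<phi> f"
    and "\<And>f. f \<in> V \<Longrightarrow> \<forall>z\<in>F. f z = 0 \<Longrightarrow> \<phi> f = 0"
  shows "\<exists>c. \<forall>f\<in>V. \<phi> f = (\<Sum>z\<in>F. c z * f z)"
  using assms(1,4-6)
proof (induction F arbitrary: \<phi> rule: finite_induct)
  case empty
  then show ?case by simp
next
  case (insert a F)
  note add = insert.prems(1) and scale = insert.prems(2) and vanish = insert.prems(3)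
  show ?case
  proof (cases "\<exists>g\<in>V. (\<forall>z\<in>F. g z = 0) \<and> g a \<noteq> 0")
    case True
    then obtain g where g: "g \<in> V" "\<forall>z\<in>F. g z = 0" "g a \<noteq> 0" by blast
    \<comment> \<open>Subtracting a multiple of the evaluation at \<open>a\<close> yields a functional that vanishes on all
      of the functionals vanishing on \<open>F\<close>.\<close>
    define d where "d = \<phi> g / g a"
    have "\<exists>c. \<forall>f\<in>V. \<phi> f - d * f a = (\<Sum>z\<in>F. c z * f z)"
    proof (rule insert.IH)
      fix f assume f: "f \<in> V" "\<forall>z\<in>F. f z = 0"
      let ?t = "- (f a / g a)"
      have "\<phi> (\<lambda>z. f z + ?t * g z) = 0"
        by (intro vanish V_add V_scale f g) (use f g in auto)
      also have "\<phi> (\<lambda>z. f z + ?t * g z) = \<phi> f + ?t * \<phi> g"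
        using add[OF f(1) V_scale[OF g(1)], of ?t] scale[OF g(1), of ?t] by simp
      finally show "\<phi> f - d * f a = 0" by (simp add: d_def field_simps)
    qed (auto simp: add scale algebra_simps)
    then obtain c where c: "\<And>f. f \<in> V \<Longrightarrow> \<phi> f - d * f a = (\<Sum>z\<in>F. c z * f z)" by blast
    have "\<phi> f = (\<Sum>z\<in>insert a F. (c(a := d)) z * f z)" if "f \<in> V" for f
    proof -
      have "(\<Sum>z\<in>F. (c(a := d)) z * f z) = (\<Sum>z\<in>F. c z * f z)"
        using insert.hyps by (intro sum.cong) auto
      then show ?thesis using c[OF that] insert.hyps by (simp add: algebra_simps)
    qed
    then show ?thesis by blast
  next
    case False
    have "\<exists>c. \<forall>f\<in>V. \<phi> f = (\<Sum>z\<in>F. c z * f z)"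
      by (rule insert.IH) (use False in \<open>auto intro: add scale vanish\<close>)
    then obtain c where c: "\<And>f. f \<in> V \<Longrightarrow> \<phi> f = (\<Sum>z\<in>F. c z * f z)" by blast
    have "\<phi> f = (\<Sum>z\<in>insert a F. (c(a := 0)) z * f z)" if "f \<in> V" for f
    proof -
      have "(\<Sum>z\<in>F. (c(a := 0)) z * f z) = (\<Sum>z\<in>F. c z * f z)"
        using insert.hyps by (intro sum.cong) auto
      then show ?thesis using c[OF that] insert.hyps by simp
    qed
    then show ?thesis by blast
  qed
qed

lemma topspace_weak_star: "topspace (weak_star smul) = dual smul"
  unfolding weak_star_def topology_generated_by_topspace by (auto intro: exI[of _ UNIV])

lemma continuous_map_weak_star_apply:
  "continuous_map (weak_star smul) euclidean (\<lambda>f. f z)"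
proof -
  have "openin (weak_star smul) {f \<in> dual smul. f z \<in> U}" if "open U" for U
    unfolding weak_star_def using that by (intro topology_generated_by_Basis) blast
  then show ?thesis by (simp add: continuous_map_def topspace_weak_star)
qed

text \<open>
  The set of functionals that agree with \<open>g\<close> on \<open>F\<close> is not itself a neighbourhood of \<open>g\<close> in
  general. That every neighbourhood contains such a set suffices for the argument below, and it
  avoids radii.
\<close>

lemma weak_star_neighbourhood:
  assumes "openin (weak_star smul) U" "g \<in> U"
  shows "\<exists>F. finite F \<and> {f \<in> dual smul. \<forall>z\<in>F. f z = g z} \<subseteq> U"
proof -
  have "generate_topology_on {{f \<in> dual smul. f z \<in> U} | z U. open U} U"
    using assms(1) by (simp add: weak_star_def openin_topology_generated_by_iff)
  then show ?thesis using assms(2)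
  proof (induction rule: generate_topology_on.induct)
    case Empty
    then show ?case by simp
  next
    case (Int A B)
    then obtain F G where "finite F" "{f \<in> dual smul. \<forall>z\<in>F. f z = g z} \<subseteq> A"
      and "finite G" "{f \<in> dual smul. \<forall>z\<in>G. f z = g z} \<subseteq> B" by blast
    then show ?case by (intro exI[of _ "F \<union> G"]) auto
  next
    case (UN K)
    then obtain A where A: "A \<in> K" "g \<in> A" by blast
    with UN.IH obtain F where "finite F" "{f \<in> dual smul. \<forall>z\<in>F. f z = g z} \<subseteq> A" by blast
    with A show ?case by (meson Union_upper subset_trans)
  next
    case (Basis A)
    then obtain z W where "A = {f \<in> dual smul. f z \<in> W}" by blast
    with Basis.prems show ?case by (intro exI[of _ "{z}"]) auto
  qed
qed

lemma weak_star_functional_eq_evaluation: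
  fixes smul :: "'k::real_normed_field \<Rightarrow> 'z::{ab_group_add,topological_space} \<Rightarrow> 'z"
  assumes vs: "vector_space smul"
    and cont: "continuous_map (weak_star smul) euclidean \<phi>"
    and add: "\<And>f g. f \<in> dual smul \<Longrightarrow> g \<in> dual smul \<Longrightarrow> \<phi> (\<lambda>z. f z + g z) = \<phi> f + \<phi> g"
    and scale: "\<And>c f. f \<in> dual smul \<Longrightarrow> \<phi> (\<lambda>z. c * f z) = c * \<phi> f"
  shows "\<exists>w. \<forall>f\<in>dual smul. \<phi> f = f w"
proof -
  let ?U = "{f \<in> dual smul. \<phi> f \<in> ball 0 1}"
  have "openin (weak_star smul) ?U"
    using openin_continuous_map_preimage[OF cont, of "ball 0 1"]
    by (simp add: topspace_weak_star)
  moreover have "(\<lambda>z. 0) \<in> ?U"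
    using zero_in_dual[OF vs] scale[of "\<lambda>z. 0" 0] by simp
  ultimately obtain F where F: "finite F" "{f \<in> dual smul. \<forall>z\<in>F. f z = 0} \<subseteq> ?U"
    using weak_star_neighbourhood[of smul ?U "\<lambda>z. 0"] by blast
  have vanish: "\<phi> f = 0" if f: "f \<in> dual smul" "\<forall>z\<in>F. f z = 0" for f
  proof (rule ccontr)
    assume nz: "\<phi> f \<noteq> 0"
    \<comment> \<open>The multiple of \<open>f\<close> on which \<open>\<phi>\<close> takes the value \<open>1\<close> would also lie in \<open>?U\<close>.\<close>
    have "(\<lambda>z. inverse (\<phi> f) * f z) \<in> ?U"
      using F(2) f scale_in_dual[OF vs f(1), of "inverse (\<phi> f)"] by auto
    then show False using nz scale[OF f(1), of "inverse (\<phi> f)"] by simp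
  qed
  obtain c where "\<forall>f\<in>dual smul. \<phi> f = (\<Sum>z\<in>F. c z * f z)"
    using functional_eq_combination_of_evaluations[of F "dual smul" \<phi>,
        OF F(1) add_in_dual[OF vs] scale_in_dual[OF vs] add scale vanish] by blast
  then have "\<forall>f\<in>dual smul. \<phi> f = f (\<Sum>z\<in>F. smul (c z) z)"
    by (simp add: dual_sum_scale_apply)
  then show ?thesis ..
qed

text \<open>
  A weak-star continuous operator and its dual operator are adjoint with respect to the pairing.
\<close>

lemma apply_dual_operator:
  fixes smul :: "'k::real_normed_field \<Rightarrow> 'z::{ab_group_add,topological_space} \<Rightarrow> 'z"
  assumes vs: "vector_space smul" and S: "S \<in> weak_star_operators smul" and f: "f \<in> dual smul"
  shows "f (dual_operator smul S z) = S f z"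
proof -
  have S_dual: "S g \<in> dual smul" if "g \<in> dual smul" for g
    using S that by (auto simp: weak_star_operators_def)
  have "continuous_map (weak_star smul) (weak_star smul) S"
    using S by (simp add: weak_star_operators_def)
  then have "continuous_map (weak_star smul) euclidean (\<lambda>g. S g z)"
    using continuous_map_compose[OF _ continuous_map_weak_star_apply[of smul z]]
    by (simp add: o_def)
  then have "\<exists>w. \<forall>g\<in>dual smul. S g z = g w"
    by (rule weak_star_functional_eq_evaluation[OF vs])
      (use S in \<open>simp_all add: weak_star_operators_def\<close>)
  then obtain w where "\<And>g. g \<in> dual smul \<Longrightarrow> S g z = g w" by blast
  then have "algebraic_adjoint smul S (evaluation smul z) = evaluation smul w"
    by (auto simp: algebraic_adjoint_def evaluation_def S_dual restrict_def)
  then have "evaluation smul (dual_operator smul S z) =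
      algebraic_adjoint smul S (evaluation smul z)"
    unfolding dual_operator_def by (simp add: f_inv_into_f)
  from fun_cong[OF this, of f] show ?thesis
    using f S_dual[OF f] by (simp add: algebraic_adjoint_def evaluation_def)
qed

lemma dual_mult_in_dual:
  assumes "frechet_algebra smul pmul" and "f \<in> dual smul"
  shows "dual_mult pmul y f \<in> dual smul"
proof -
  interpret frechet_algebra smul pmul by fact
  have "continuous_on UNIV (\<lambda>z. pmul y z)"
    using continuous_on_compose2[OF continuous_mult, of UNIV "\<lambda>z. (y, z)"]
    by (simp add: continuous_on_Pair)
  then have "continuous_on UNIV (\<lambda>z. f (pmul y z))"
    using assms(2) by (auto simp: dual_iff intro: continuous_on_compose2)
  moreover have "Vector_Spaces.linear smul (*) (\<lambda>z. f (pmul y z))"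
    using Vector_Spaces.linear_compose[OF linear_mult_right, of "(*)" f y] assms(2)
    by (simp add: dual_iff o_def)
  ultimately show ?thesis by (simp add: dual_iff dual_mult_def)
qed

lemma weak_star_operator_dual_mult:
  assumes alg: "frechet_algebra smul pmul"
    and S: "S \<in> weak_star_operators smul"
    and deriv: "derivative_operator pmul (dual_operator smul S)"
    and f: "f \<in> dual smul"
  shows "S (dual_mult pmul \<theta> f) z =
    dual_mult pmul \<theta> (S f) z - dual_mult pmul (dual_operator smul S \<theta>) f z"
proof -
  interpret frechet_algebra smul pmul by fact
  let ?D = "dual_operator smul S"
  have dual: "g (?D y) = S g y" if "g \<in> dual smul" for g y
    using apply_dual_operator[OF vector_space_axioms S that] .
  have "S (dual_mult pmul \<theta> f) z = f (pmul \<theta> (?D z))"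
    using dual[OF dual_mult_in_dual[OF alg f], of \<theta> z] by (simp add: dual_mult_def)
  moreover have "S f (pmul \<theta> z) = f (pmul \<theta> (?D z)) + f (pmul (?D \<theta>) z)"
    using dual[OF f, of "pmul \<theta> z"] deriv dual_add_apply[OF f]
    by (simp add: derivative_operator_def)
  ultimately show ?thesis by (simp add: dual_mult_def)
qed

theorem proposition4p11:
  fixes smul :: "'k::{real_normed_field,euclidean_space} \<Rightarrow> 'z::{ab_group_add,topological_space} \<Rightarrow> 'z"
    and pmul :: "'z \<Rightarrow> 'z \<Rightarrow> 'z"
    and M \<mu> :: "'m measure"
    and \<theta> :: 'z
    and \<xi> :: "'m set \<Rightarrow> 'z \<Rightarrow> 'k"
    and \<Xi> :: "('m \<Rightarrow> 'z \<Rightarrow> 'k) \<Rightarrow> ('m \<Rightarrow> 'z \<Rightarrow> 'k)"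
    and \<Xi>\<^sub>p :: "'m \<Rightarrow> ('z \<Rightarrow> 'k) \<Rightarrow> ('z \<Rightarrow> 'k)"
  assumes "frechet_algebra smul pmul"
    and "integrator smul M \<mu> \<Xi> \<xi>"
    and "\<And>x. x \<in> space M \<Longrightarrow> \<Xi>\<^sub>p x \<in> weak_star_operators smul"
    and "\<And>\<gamma> x. \<gamma> \<in> integrable_maps smul \<mu> \<Xi> \<Longrightarrow> x \<in> space M \<Longrightarrow> \<Xi> \<gamma> x = \<Xi>\<^sub>p x (\<gamma> x)"
    and "\<And>x. x \<in> space M \<Longrightarrow> derivative_operator pmul (dual_operator smul (\<Xi>\<^sub>p x))"
  shows "\<forall>\<gamma> \<in> integrable_maps smul \<mu> \<Xi>.
    (\<lambda>x\<in>space M. dual_mult pmul \<theta> (\<gamma> x)) \<in> integrable_maps smul \<mu> \<Xi> \<longrightarrow>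
      gelfand_integrable smul \<mu>
        (\<lambda>x\<in>space M. dual_mult pmul (dual_operator smul (\<Xi>\<^sub>p x) \<theta>) (\<gamma> x)) \<and>
      (\<forall>E\<in>sets M.
        integrator_integral \<mu> \<Xi> E (\<lambda>x\<in>space M. dual_mult pmul \<theta> (\<gamma> x)) =
        (\<lambda>z. dual_mult pmul \<theta> (integrator_integral \<mu> \<Xi> E \<gamma>) z -
          gelfand_integral \<mu> E
            (\<lambda>x\<in>space M. dual_mult pmul (dual_operator smul (\<Xi>\<^sub>p x) \<theta>) (\<gamma> x)) z))"
proof (intro ballI impI)
  fix \<gamma> :: "'m \<Rightarrow> 'z \<Rightarrow> 'k"
  let ?\<gamma>\<theta> = "\<lambda>x\<in>space M. dual_mult pmul \<theta> (\<gamma> x)"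
  let ?\<delta> = "\<lambda>x\<in>space M. dual_mult pmul (dual_operator smul (\<Xi>\<^sub>p x) \<theta>) (\<gamma> x)"
  assume \<gamma>: "\<gamma> \<in> integrable_maps smul \<mu> \<Xi>" and \<gamma>\<theta>: "?\<gamma>\<theta> \<in> integrable_maps smul \<mu> \<Xi>"
  have sets: "sets \<mu> = sets M" using assms(2) by (simp add: integrator_def)
  then have space: "space \<mu> = space M" by (rule sets_eq_imp_space_eq)
  have \<gamma>_dual: "\<gamma> x \<in> dual smul" if "x \<in> space M" for x
    using \<gamma> that space by (auto simp: integrable_maps_def dual_maps_def)
  have pointwise: "?\<delta> x z = \<Xi> \<gamma> x (pmul \<theta> z) - \<Xi> ?\<gamma>\<theta> x z" if x: "x \<in> space M" for x z
    using weak_star_operator_dual_mult[OF assms(1) assms(3)[OF x] assms(5)[OF x] \<gamma>_dual[OF x]]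
      assms(4)[OF \<gamma> x] assms(4)[OF \<gamma>\<theta> x] x
    by (simp add: dual_mult_def)
  have int: "integrable \<mu> (\<lambda>x. \<Xi> \<gamma> x z)" "integrable \<mu> (\<lambda>x. \<Xi> ?\<gamma>\<theta> x z)" for z
    using \<gamma> \<gamma>\<theta> by (auto simp: integrable_maps_def gelfand_integrable_def)
  have "integrable \<mu> (\<lambda>x. ?\<delta> x z)" for z
  proof -
    have "integrable \<mu> (\<lambda>x. \<Xi> \<gamma> x (pmul \<theta> z) - \<Xi> ?\<gamma>\<theta> x z)"
      by (intro Bochner_Integration.integrable_diff int)
    then show ?thesis
      by (rule Bochner_Integration.integrable_cong[THEN iffD1, rotated -1])
        (use pointwise space in auto)
  qed
  moreover have "?\<delta> \<in> dual_maps smul \<mu>"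
    using dual_mult_in_dual[OF assms(1) \<gamma>_dual] by (auto simp: dual_maps_def space)
  ultimately have "gelfand_integrable smul \<mu> ?\<delta>" by (simp add: gelfand_integrable_def)
  moreover have "integrator_integral \<mu> \<Xi> E ?\<gamma>\<theta> =
      (\<lambda>z. dual_mult pmul \<theta> (integrator_integral \<mu> \<Xi> E \<gamma>) z - gelfand_integral \<mu> E ?\<delta> z)"
    if E: "E \<in> sets M" for E
  proof
    fix z
    have set_int: "set_integrable \<mu> E f" if "integrable \<mu> f" for f :: "'m \<Rightarrow> 'k"
      using that E sets by (simp add: set_integrable_def integrable_mult_indicator)
    have "gelfand_integral \<mu> E ?\<delta> z = (LINT x:E|\<mu>. \<Xi> \<gamma> x (pmul \<theta> z) - \<Xi> ?\<gamma>\<theta> x z)"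
      unfolding gelfand_integral_def
      by (intro set_lebesgue_integral_cong allI impI pointwise)
        (use E sets sets.sets_into_space in auto)
    also have "\<dots> = (LINT x:E|\<mu>. \<Xi> \<gamma> x (pmul \<theta> z)) - (LINT x:E|\<mu>. \<Xi> ?\<gamma>\<theta> x z)"
      by (intro set_integral_diff set_int int)
    finally show "integrator_integral \<mu> \<Xi> E ?\<gamma>\<theta> z =
        dual_mult pmul \<theta> (integrator_integral \<mu> \<Xi> E \<gamma>) z - gelfand_integral \<mu> E ?\<delta> z"
      by (simp add: integrator_integral_def gelfand_integral_def dual_mult_def)
  qed
  ultimately show "gelfand_integrable smul \<mu> ?\<delta> \<and> (\<forall>E\<in>sets M. integrator_integral \<mu> \<Xi> E ?\<gamma>\<theta> =
      (\<lambda>z. dual_mult pmul \<theta> (integrator_integral \<mu> \<Xi> E \<gamma>) z - gelfand_integral \<mu> E ?\<delta> z))"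
    by blast
qed

end
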